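(* Let $(\gamma_t,v_1,v_2):I\to AdS^3\times\Delta_5$ be a pseudo-spherical timelike framed curve with curvature $(\alpha,\ell,m,n)$. Let $\phi\in\mathbb{R}$ be fixed and let $\theta:I\to\mathbb{R}$ be smooth with $\theta'=-\ell$. Define $$\gamma_t^\phi=\cosh\phi\,\gamma_t+\sinh\phi(\cos\theta\,v_1+\sin\theta\,v_2),$$ $$v_1^\phi=\sinh\phi\,\gamma_t+\cosh\phi(\cos\theta\,v_1+\sin\theta\,v_2),\qquad v_2^\phi=-\sin\theta\,v_1+\cos\theta\,v_2 .$$ Then $(\gamma_t^\phi,v_1^\phi,v_2^\phi):I\to AdS^3\times\Delta_5$ is a pseudo-spherical timelike framed curve with curvature $(\alpha^\phi,0,m^\phi,n^\phi)$, where $$\alpha^\phi=\cosh\phi\,\alpha+\sinh\phi(\cos\theta\,m+\sin\theta\,n),\quad m^\phi=\sinh\phi\,\alpha+\cosh\phi(\cos\theta\,m+\sin\theta\,n),\quad n^\phi=-\sin\theta\,m+\cos\theta\,n .$$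
   Context: $\mathbb{R}^4_2$ is $\mathbb{R}^4$ with $\langle u,w\rangle=-u_1w_1-u_2w_2+u_3w_3+u_4w_4$; the triple product $u\times v\times w$ is the unique vector with $\langle x,u\times v\times w\rangle=\det(x,u,v,w)$ for all $x$. $AdS^3=\{u:\langle u,u\rangle=-1\}$, $S^3_2=\{u:\langle u,u\rangle=1\}$, $\Delta_5=\{(u,w)\in S^3_2\times S^3_2:\langle u,w\rangle=0\}$. $I$ is an interval. A pseudo-spherical timelike framed curve is a smooth map $(\gamma_t,v_1,v_2):I\to AdS^3\times\Delta_5$ with $\langle\gamma_t,v_i\rangle=0$ and $\langle\gamma_t',v_i\rangle=0$ on $I$ for $i=1,2$. Put $\mu=\gamma_t\times v_1\times v_2$. The curvature is $(\alpha,\ell,m,n)$ with $\alpha=-\langle\gamma_t',\mu\rangle$, $\ell=\langle v_1',v_2\rangle$, $m=-\langle v_1',\mu\rangle$, $n=-\langle v_2',\mu\rangle$; equivalently $\gamma_t'=\alpha\mu$, $v_1'=\ell v_2+m\mu$, $v_2'=-\ell v_1+n\mu$, $\mu'=-\alpha\gamma_t+mv_1+nv_2$. The curve $\gamma_t^\phi$ is called the anti-de Sitter parallel of $\gamma_t$. *)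

theory Defs
  imports "HOL-Analysis.Analysis"
begin

definition pseudo_inner :: "real^4 \<Rightarrow> real^4 \<Rightarrow> real" where
  "pseudo_inner u w = - (u $ 1 * w $ 1) - u $ 2 * w $ 2 + u $ 3 * w $ 3 + u $ 4 * w $ 4"

text \<open>The determinant of four vectors is that of the matrix with these vectors as rows.\<close>

definition triple_prod :: "real^4 \<Rightarrow> real^4 \<Rightarrow> real^4 \<Rightarrow> real^4" where
  "triple_prod u v w =
     (THE p. \<forall>x. pseudo_inner x p = det (vector [x, u, v, w] :: real^4^4))"

definition AdS3 :: "(real^4) set" where
  "AdS3 = {u. pseudo_inner u u = -1}"

definition S32 :: "(real^4) set" where
  "S32 = {u. pseudo_inner u u = 1}"

definition Delta5 :: "((real^4) \<times> (real^4)) set" where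
  "Delta5 = {(u, w). u \<in> S32 \<and> w \<in> S32 \<and> pseudo_inner u w = 0}"

text \<open>Derivatives are taken within the interval, hence one-sided at an endpoint that belongs
  to it; at interior points they are the ordinary derivatives.\<close>

primrec iter_deriv_on ::
    "real set \<Rightarrow> nat \<Rightarrow> (real \<Rightarrow> 'a::real_normed_vector) \<Rightarrow> real \<Rightarrow> 'a" where
  "iter_deriv_on I 0 f = f"
| "iter_deriv_on I (Suc k) f = (\<lambda>t. vector_derivative (iter_deriv_on I k f) (at t within I))"

definition smooth_on :: "real set \<Rightarrow> (real \<Rightarrow> 'a::real_normed_vector) \<Rightarrow> bool" where
  "smooth_on I f \<longleftrightarrow> (\<forall>k. iter_deriv_on I k f differentiable_on I)"

definition timelike_framed_curve ::
    "real set \<Rightarrow> (real \<Rightarrow> real^4) \<Rightarrow> (real \<Rightarrow> real^4) \<Rightarrow> (real \<Rightarrow> real^4) \<Rightarrow> bool" where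
  "timelike_framed_curve I \<gamma> v1 v2 \<longleftrightarrow>
     smooth_on I (\<lambda>t. (\<gamma> t, v1 t, v2 t)) \<and>
     (\<forall>t\<in>I. (\<gamma> t, v1 t, v2 t) \<in> AdS3 \<times> Delta5) \<and>
     (\<forall>t\<in>I. \<forall>v\<in>{v1, v2}. pseudo_inner (\<gamma> t) (v t) = 0 \<and>
        pseudo_inner (vector_derivative \<gamma> (at t within I)) (v t) = 0)"

definition framed_curvature ::
    "real set \<Rightarrow> (real \<Rightarrow> real^4) \<Rightarrow> (real \<Rightarrow> real^4) \<Rightarrow> (real \<Rightarrow> real^4) \<Rightarrow>
     real \<Rightarrow> real \<times> real \<times> real \<times> real" where
  "framed_curvature I \<gamma> v1 v2 t =
     (let \<mu> = triple_prod (\<gamma> t) (v1 t) (v2 t);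
          \<gamma>' = vector_derivative \<gamma> (at t within I);
          v1' = vector_derivative v1 (at t within I);
          v2' = vector_derivative v2 (at t within I)
      in (- pseudo_inner \<gamma>' \<mu>, pseudo_inner v1' (v2 t), - pseudo_inner v1' \<mu>, - pseudo_inner v2' \<mu>))"

definition AdS_parallel ::
    "real \<Rightarrow> (real \<Rightarrow> real) \<Rightarrow> (real \<Rightarrow> real^4) \<Rightarrow> (real \<Rightarrow> real^4) \<Rightarrow> (real \<Rightarrow> real^4) \<Rightarrow>
     real \<Rightarrow> real^4" where
  "AdS_parallel \<phi> \<theta> \<gamma> v1 v2 t =
     cosh \<phi> *\<^sub>R \<gamma> t + sinh \<phi> *\<^sub>R (cos (\<theta> t) *\<^sub>R v1 t + sin (\<theta> t) *\<^sub>R v2 t)"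

definition parallel_v1 ::
    "real \<Rightarrow> (real \<Rightarrow> real) \<Rightarrow> (real \<Rightarrow> real^4) \<Rightarrow> (real \<Rightarrow> real^4) \<Rightarrow> (real \<Rightarrow> real^4) \<Rightarrow>
     real \<Rightarrow> real^4" where
  "parallel_v1 \<phi> \<theta> \<gamma> v1 v2 t =
     sinh \<phi> *\<^sub>R \<gamma> t + cosh \<phi> *\<^sub>R (cos (\<theta> t) *\<^sub>R v1 t + sin (\<theta> t) *\<^sub>R v2 t)"

definition parallel_v2 ::
    "(real \<Rightarrow> real) \<Rightarrow> (real \<Rightarrow> real^4) \<Rightarrow> (real \<Rightarrow> real^4) \<Rightarrow> real \<Rightarrow> real^4" where
  "parallel_v2 \<theta> v1 v2 t = - (sin (\<theta> t) *\<^sub>R v1 t) + cos (\<theta> t) *\<^sub>R v2 t"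

lemma linear_det_row1: "linear (\<lambda>x. det (vector [x, u, v, w] :: real^4^4))"
proof -
  define c where "c = (\<lambda>i. (vector [0, u, v, w] :: real^4^4) $ i)"
  have e: "(vector [x, u, v, w] :: real^4^4) = (\<chi> i. if i = 1 then x else c i)" for x
    unfolding c_def vec_eq_iff forall_4 by (simp add: vector_def)
  show ?thesis
    unfolding e
    using det_row_add[of 1 _ _ c] det_row_mul[of 1 _ _ c]
    by (intro linearI) (simp_all only: scalar_mult_eq_scaleR[symmetric] real_scaleR_def)
qed

lemma triple_prod_ex1:
  "\<exists>!p. \<forall>x. pseudo_inner x p = det (vector [x, u, v, w] :: real^4^4)"
proof -
  define f where "f = (\<lambda>x. det (vector [x, u, v, w] :: real^4^4))"
  have lin: "linear f" unfolding f_def by (rule linear_det_row1)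
  define p :: "real^4" where
    "p = vector [- f (axis 1 1), - f (axis 2 1), f (axis 3 1), f (axis 4 1)]"
  have p: "p $ 1 = - f (axis 1 1)" "p $ 2 = - f (axis 2 1)"
    "p $ 3 = f (axis 3 1)" "p $ 4 = f (axis 4 1)"
    by (simp_all add: p_def vector_def)
  have "pseudo_inner x p = f x" for x
  proof -
    have "f x = f (\<Sum>i\<in>UNIV. x $ i *\<^sub>R axis i 1)"
      using basis_expansion[of x] by (simp add: scalar_mult_eq_scaleR)
    also have "\<dots> = (\<Sum>i\<in>UNIV. x $ i * f (axis i 1))"
      by (simp add: linear_sum[OF lin] linear_scale[OF lin])
    finally show ?thesis by (simp add: sum_4 pseudo_inner_def p)
  qed
  moreover have "q = p" if "\<forall>x. pseudo_inner x q = f x" for q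
  proof -
    have "pseudo_inner x q = pseudo_inner x p" for x
      using that calculation by simp
    from this[of "axis 1 1"] this[of "axis 2 1"] this[of "axis 3 1"] this[of "axis 4 1"]
    show ?thesis by (simp add: vec_eq_iff forall_4 pseudo_inner_def axis_def)
  qed
  ultimately show ?thesis unfolding f_def by blast
qed

lemma pseudo_inner_triple_prod:
  "pseudo_inner x (triple_prod u v w) = det (vector [x, u, v, w] :: real^4^4)"
  using theI'[OF triple_prod_ex1[of u v w]] unfolding triple_prod_def by blast

end

theory Submission
  imports Defs
begin

text \<open>Rotating the normal frame by \<open>\<theta>\<close> with \<open>\<theta>' = -\<ell>\<close> produces a framed curve with vanishing \<open>\<ell>\<close>
  (a Bishop frame) and with \<open>(m, n)\<close> rotated. The parallel is then obtained from that framed curve by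
  a constant hyperbolic rotation in the plane of \<open>\<gamma>\<close> and the first normal. Both rotations have
  determinant one, so they leave \<open>\<mu>\<close> unchanged.\<close>

section \<open>Smoothness on a set without isolated points\<close>

text \<open>An inductive counterpart of \<open>iter_deriv_on\<close>: a witness \<open>f'\<close>
  replaces the chosen \<open>vector_derivative\<close>, and the innermost derivative is peeled off
  first. Closure properties then follow by induction over all functions, with no function equalities
  off \<open>I\<close> to maintain.\<close>

primrec times_differentiable_on ::
    "real set \<Rightarrow> nat \<Rightarrow> (real \<Rightarrow> 'a::real_normed_vector) \<Rightarrow> bool" where
  "times_differentiable_on I 0 f = True"
| "times_differentiable_on I (Suc k) f =
     (\<exists>f'. (\<forall>t\<in>I. (f has_vector_derivative f' t) (at t within I)) \<and> times_differentiable_on I k f')"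

text \<open>Derivatives within \<open>I\<close> see only values on \<open>I\<close>. This allows one
  derivative to be exchanged for another that agrees with it on \<open>I\<close> alone.\<close>

lemma times_differentiable_on_cong:
  assumes "times_differentiable_on I k f" "\<And>t. t \<in> I \<Longrightarrow> g t = f t"
  shows "times_differentiable_on I k g"
proof (cases k)
  case (Suc j)
  then obtain f' where
    "\<forall>t\<in>I. (f has_vector_derivative f' t) (at t within I)" "times_differentiable_on I j f'"
    using assms(1) by auto
  then show ?thesis
    using Suc assms(2) has_vector_derivative_transform[of _ I g f]
    by (auto intro!: exI[of _ f'])
qed simp

lemma times_differentiable_on_SucD:
  "times_differentiable_on I (Suc k) f \<Longrightarrow> times_differentiable_on I k f"
  by (induction k arbitrary: f) auto

section \<open>Closure under sums, linear and bilinear maps, cosine and sine, and pairing\<close>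

lemma times_differentiable_on_add:
  "times_differentiable_on I k f \<Longrightarrow> times_differentiable_on I k g \<Longrightarrow>
     times_differentiable_on I k (\<lambda>t. f t + g t)"
proof (induction k arbitrary: f g)
  case (Suc k)
  then obtain f' g' where
    "\<forall>t\<in>I. (f has_vector_derivative f' t) (at t within I)" "times_differentiable_on I k f'"
    "\<forall>t\<in>I. (g has_vector_derivative g' t) (at t within I)" "times_differentiable_on I k g'"
    by auto
  then show ?case
    using Suc.IH[of f' g'] by (auto intro!: exI[of _ "\<lambda>t. f' t + g' t"] has_vector_derivative_add)
qed simp

lemma (in bounded_linear) times_differentiable_on:
  "times_differentiable_on I k g \<Longrightarrow> times_differentiable_on I k (\<lambda>t. f (g t))"
proof (induction k arbitrary: g)
  case (Suc k)
  then obtain g' where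
    "\<forall>t\<in>I. (g has_vector_derivative g' t) (at t within I)" "times_differentiable_on I k g'"
    by auto
  then show ?case
    using Suc.IH[of g'] by (auto intro!: exI[of _ "\<lambda>t. f (g' t)"] has_vector_derivative)
qed simp

lemma (in bounded_bilinear) times_differentiable_on:
  "times_differentiable_on I k f \<Longrightarrow> times_differentiable_on I k g \<Longrightarrow>
     times_differentiable_on I k (\<lambda>t. prod (f t) (g t))"
proof (induction k arbitrary: f g)
  case (Suc k)
  obtain f' g' where
    *: "\<forall>t\<in>I. (f has_vector_derivative f' t) (at t within I)" "times_differentiable_on I k f'"
       "\<forall>t\<in>I. (g has_vector_derivative g' t) (at t within I)" "times_differentiable_on I k g'"
    using Suc.prems by auto
  \<comment> \<open>Each summand of the product rule keeps one factor undifferentiated. That factor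
    has order \<open>Suc k\<close>, so it is lowered to order \<open>k\<close> before the induction
    hypothesis applies.\<close>
  have "times_differentiable_on I k (\<lambda>t. prod (f t) (g' t) + prod (f' t) (g t))"
    using * Suc.prems[THEN times_differentiable_on_SucD]
    by (intro times_differentiable_on_add Suc.IH)
  with * show ?case
    by (auto intro!: exI[of _ "\<lambda>t. prod (f t) (g' t) + prod (f' t) (g t)"] has_vector_derivative)
qed simp

lemmas times_differentiable_on_scaleR =
  bounded_bilinear.times_differentiable_on[OF bounded_bilinear_scaleR]

lemma has_vector_derivative_cos_sin:
  fixes \<theta> :: "real \<Rightarrow> real"
  assumes "(\<theta> has_vector_derivative d) (at t within I)"
  shows "((\<lambda>t. cos (\<theta> t)) has_vector_derivative - (d * sin (\<theta> t))) (at t within I)"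
    and "((\<lambda>t. sin (\<theta> t)) has_vector_derivative d * cos (\<theta> t)) (at t within I)"
  using assms by (auto simp flip: has_real_derivative_iff_has_vector_derivative
      intro!: derivative_eq_intros)

lemma times_differentiable_on_cos_sin:
  fixes \<theta> :: "real \<Rightarrow> real"
  assumes "times_differentiable_on I k \<theta>"
  shows "times_differentiable_on I k (\<lambda>t. cos (\<theta> t))" "times_differentiable_on I k (\<lambda>t. sin (\<theta> t))"
proof -
  \<comment> \<open>The derivative of each function contains the other, so both go through one
    induction.\<close>
  have "times_differentiable_on I k (\<lambda>t. cos (\<theta> t)) \<and> times_differentiable_on I k (\<lambda>t. sin (\<theta> t))"
    using assms
  proof (induction k)
    case (Suc k)
    obtain d where
      d: "\<forall>t\<in>I. (\<theta> has_vector_derivative d t) (at t within I)" "times_differentiable_on I k d"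
      using Suc.prems by auto
    have "times_differentiable_on I k (\<lambda>t. cos (\<theta> t))" "times_differentiable_on I k (\<lambda>t. sin (\<theta> t))"
      using Suc times_differentiable_on_SucD by blast+
    with d(2) have "times_differentiable_on I k (\<lambda>t. - (d t * sin (\<theta> t)))"
      "times_differentiable_on I k (\<lambda>t. d t * cos (\<theta> t))"
      by (auto intro!: bounded_bilinear.times_differentiable_on[OF bounded_bilinear_mult]
          bounded_linear.times_differentiable_on[OF bounded_linear_minus[OF bounded_linear_ident]])
    moreover have
      "\<forall>t\<in>I. ((\<lambda>t. cos (\<theta> t)) has_vector_derivative - (d t * sin (\<theta> t))) (at t within I)"
      "\<forall>t\<in>I. ((\<lambda>t. sin (\<theta> t)) has_vector_derivative d t * cos (\<theta> t)) (at t within I)"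
      using has_vector_derivative_cos_sin[OF d(1)[rule_format]] by simp_all
    ultimately show ?case
      unfolding times_differentiable_on.simps by (intro conjI exI)
  qed simp
  then show "times_differentiable_on I k (\<lambda>t. cos (\<theta> t))"
    "times_differentiable_on I k (\<lambda>t. sin (\<theta> t))" by auto
qed

lemma times_differentiable_on_Pair:
  "times_differentiable_on I k f \<Longrightarrow> times_differentiable_on I k g \<Longrightarrow>
     times_differentiable_on I k (\<lambda>t. (f t, g t))"
proof (induction k arbitrary: f g)
  case (Suc k)
  then obtain f' g' where
    "\<forall>t\<in>I. (f has_vector_derivative f' t) (at t within I)" "times_differentiable_on I k f'"
    "\<forall>t\<in>I. (g has_vector_derivative g' t) (at t within I)" "times_differentiable_on I k g'"
    by auto
  then show ?case
    using Suc.IH[of f' g']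
    by (auto intro!: exI[of _ "\<lambda>t. (f' t, g' t)"] has_vector_derivative_Pair)
qed simp

text \<open>The recursion of \<open>iter_deriv_on\<close> differentiates outermost, whereas
  \<open>times_differentiable_on\<close> peels off the innermost derivative; this reconciles the two
  orders.\<close>

lemma iter_deriv_on_Suc_shift:
  "iter_deriv_on I (Suc k) f = iter_deriv_on I k (\<lambda>t. vector_derivative f (at t within I))"
  by (induction k) auto

lemma smooth_on_has_vector_derivative:
  assumes "smooth_on I f" "t \<in> I"
  shows "(f has_vector_derivative vector_derivative f (at t within I)) (at t within I)"
proof -
  have "iter_deriv_on I 0 f differentiable_on I"
    using assms(1) unfolding smooth_on_def by blast
  then show ?thesis
    using assms(2) by (simp add: differentiable_on_def vector_derivative_works)
qed

lemma smooth_on_vector_derivative: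
  "smooth_on I f \<Longrightarrow> smooth_on I (\<lambda>t. vector_derivative f (at t within I))"
  unfolding smooth_on_def by (metis iter_deriv_on_Suc_shift)

lemma smooth_on_imp_times_differentiable_on:
  "smooth_on I f \<Longrightarrow> times_differentiable_on I k f"
proof (induction k arbitrary: f)
  case (Suc k)
  then show ?case
    by (auto intro!: exI[of _ "\<lambda>t. vector_derivative f (at t within I)"]
        smooth_on_vector_derivative smooth_on_has_vector_derivative)
qed simp

text \<open>At non-isolated points the derivative within \<open>I\<close> is unique, so each witness
  equals \<open>vector_derivative\<close> on \<open>I\<close>. The order is \<open>Suc k\<close>
  because the \<open>k\<close>-th derivative must itself be differentiable.\<close>

lemma times_differentiable_on_imp_differentiable_on:
  assumes "\<And>t. t \<in> I \<Longrightarrow> at t within I \<noteq> bot"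
  shows "times_differentiable_on I (Suc k) f \<Longrightarrow> iter_deriv_on I k f differentiable_on I"
proof (induction k arbitrary: f)
  case 0
  then show ?case
    by (auto simp: differentiable_on_def intro: differentiableI_vector)
next
  case (Suc k)
  then obtain f' where
    f': "\<forall>t\<in>I. (f has_vector_derivative f' t) (at t within I)" "times_differentiable_on I (Suc k) f'"
    by auto
  then have "times_differentiable_on I (Suc k) (\<lambda>t. vector_derivative f (at t within I))"
    using assms by (elim times_differentiable_on_cong) (simp add: vector_derivative_within)
  then show ?case
    unfolding iter_deriv_on_Suc_shift by (rule Suc.IH)
qed

lemma smooth_on_iff_times_differentiable_on:
  assumes "\<And>t. t \<in> I \<Longrightarrow> at t within I \<noteq> bot"
  shows "smooth_on I f \<longleftrightarrow> (\<forall>k. times_differentiable_on I k f)"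
  using smooth_on_imp_times_differentiable_on times_differentiable_on_imp_differentiable_on[OF assms]
  unfolding smooth_on_def by blast

text \<open>Nonempty interior excludes a singleton, and every point of a connected set with more
  than one point is a limit point. Endpoints belonging to \<open>I\<close> are thus covered
  too.\<close>

lemma interval_at_within_neq_bot:
  fixes I :: "real set"
  assumes "is_interval I" "interior I \<noteq> {}" "t \<in> I"
  shows "at t within I \<noteq> bot"
proof -
  have "I \<noteq> {x}" for x
    using assms(2) by auto
  then have "t islimpt I"
    using assms by (intro connected_imp_perfect is_interval_connected)
  then show ?thesis
    by (simp add: trivial_limit_within)
qed

section \<open>The pseudo-scalar product and the triple product\<close>

text \<open>Bilinearity suffices in finite dimension. Boundedness is what gives access to the
  product rule for derivatives.\<close>

lemma bounded_bilinear_pseudo_inner: "bounded_bilinear pseudo_inner"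
  unfolding bilinear_conv_bounded_bilinear[symmetric] bilinear_def
  by (auto intro!: linearI simp: pseudo_inner_def algebra_simps)

interpretation pseudo_inner: bounded_bilinear pseudo_inner
  by (rule bounded_bilinear_pseudo_inner)

lemmas pseudo_inner_linear_simps =
  pseudo_inner.add_left pseudo_inner.add_right pseudo_inner.minus_left pseudo_inner.minus_right
  pseudo_inner.diff_left pseudo_inner.diff_right pseudo_inner.scaleR_left pseudo_inner.scaleR_right

lemma pseudo_inner_commute: "pseudo_inner u w = pseudo_inner w u"
  by (simp add: pseudo_inner_def mult.commute)

text \<open>Differentiate the constant product and use uniqueness of the derivative. With
  \<open>f = g\<close> the conclusion says that the product of \<open>f'\<close> and
  \<open>f\<close> vanishes; in general it gives the skew-symmetry of the structure
  equations.\<close>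

lemma pseudo_inner_constant_imp:
  assumes "\<And>t. t \<in> I \<Longrightarrow> at t within I \<noteq> bot" "t \<in> I"
    and "\<And>s. s \<in> I \<Longrightarrow> pseudo_inner (f s) (g s) = c"
    and "(f has_vector_derivative f') (at t within I)" "(g has_vector_derivative g') (at t within I)"
  shows "pseudo_inner f' (g t) = - pseudo_inner g' (f t)"
proof -
  have "((\<lambda>s. pseudo_inner (f s) (g s)) has_vector_derivative
      pseudo_inner (f t) g' + pseudo_inner f' (g t)) (at t within I)"
    using assms(4,5) by (rule pseudo_inner.has_vector_derivative)
  moreover have "((\<lambda>s. pseudo_inner (f s) (g s)) has_vector_derivative 0) (at t within I)"
    using assms(2,3) by (auto intro: has_vector_derivative_transform[where f = "\<lambda>_. c"])
  ultimately have "pseudo_inner (f t) g' + pseudo_inner f' (g t) = 0"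
    using vector_derivative_unique_within assms(1,2) by blast
  then show ?thesis
    by (simp add: pseudo_inner_commute)
qed

section \<open>Determinants and invariance of the triple product\<close>

lemma vector_4:
  "(vector [x, y, z, w] :: 'a::zero^4) $ 1 = x" "(vector [x, y, z, w] :: 'a^4) $ 2 = y"
  "(vector [x, y, z, w] :: 'a^4) $ 3 = z" "(vector [x, y, z, w] :: 'a^4) $ 4 = w"
  by (simp_all add: vector_def)

text \<open>Laplace expansion along the first row. The sum over permutations of four indices is
  split one index at a time, each permutation being a transposition composed with a permutation of
  the remaining indices.\<close>

lemma det_4:
  "det (A :: 'a::comm_ring_1^4^4) =
     A$1$1 * (A$2$2 * (A$3$3 * A$4$4 - A$3$4 * A$4$3) - A$2$3 * (A$3$2 * A$4$4 - A$3$4 * A$4$2)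
       + A$2$4 * (A$3$2 * A$4$3 - A$3$3 * A$4$2))
   - A$1$2 * (A$2$1 * (A$3$3 * A$4$4 - A$3$4 * A$4$3) - A$2$3 * (A$3$1 * A$4$4 - A$3$4 * A$4$1)
       + A$2$4 * (A$3$1 * A$4$3 - A$3$3 * A$4$1))
   + A$1$3 * (A$2$1 * (A$3$2 * A$4$4 - A$3$4 * A$4$2) - A$2$2 * (A$3$1 * A$4$4 - A$3$4 * A$4$1)
       + A$2$4 * (A$3$1 * A$4$2 - A$3$2 * A$4$1))
   - A$1$4 * (A$2$1 * (A$3$2 * A$4$3 - A$3$3 * A$4$2) - A$2$2 * (A$3$1 * A$4$3 - A$3$3 * A$4$1)
       + A$2$3 * (A$3$1 * A$4$2 - A$3$2 * A$4$1))"
proof -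
  have f1234: "finite {2::4, 3, 4}" "1 \<notin> {2::4, 3, 4}" by auto
  have f234: "finite {3::4, 4}" "2 \<notin> {3::4, 4}" by auto
  have f34: "finite {4::4}" "3 \<notin> {4::4}" by auto
  show ?thesis
    unfolding det_def UNIV_4
    unfolding sum_over_permutations_insert[OF f1234]
    unfolding sum_over_permutations_insert[OF f234]
    unfolding sum_over_permutations_insert[OF f34]
    unfolding permutes_sing
    by (simp add: sign_swap_id permutation_swap_id sign_compose sign_id swap_id_eq
        permutation_compose algebra_simps)
qed

text \<open>Each product is a determinant with two equal rows.\<close>

lemma pseudo_inner_triple_prod_self:
  "pseudo_inner u (triple_prod u v w) = 0" "pseudo_inner v (triple_prod u v w) = 0"
  "pseudo_inner w (triple_prod u v w) = 0"
  unfolding pseudo_inner_triple_prod by (simp_all add: det_4 vector_4 algebra_simps)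

lemma triple_prod_eqI:
  assumes "\<And>x. det (vector [x, u, v, w] :: real^4^4) = det (vector [x, u', v', w'] :: real^4^4)"
  shows "triple_prod u v w = triple_prod u' v' w'"
  unfolding triple_prod_def by (simp add: assms)

text \<open>Mixing two rows multiplies the determinant by that of the coefficient matrix,
  \<open>a * d - b * c\<close>. This serves the hyperbolic rotation of the curve and its first
  normal.\<close>

lemma triple_prod_transform_12:
  assumes "a * d - b * c = 1"
  shows "triple_prod (a *\<^sub>R u + b *\<^sub>R v) (c *\<^sub>R u + d *\<^sub>R v) w = triple_prod u v w"
proof (rule triple_prod_eqI)
  fix x :: "real^4"
  have "det (vector [x, a *\<^sub>R u + b *\<^sub>R v, c *\<^sub>R u + d *\<^sub>R v, w] :: real^4^4) =
      (a * d - b * c) * det (vector [x, u, v, w] :: real^4^4)"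
    unfolding det_4 vector_4 by (simp, algebra)
  then show "det (vector [x, a *\<^sub>R u + b *\<^sub>R v, c *\<^sub>R u + d *\<^sub>R v, w] :: real^4^4) =
      det (vector [x, u, v, w] :: real^4^4)"
    by (simp add: assms)
qed

text \<open>The same argument for the two normals, which serves the rotation by
  \<open>\<theta>\<close>.\<close>

lemma triple_prod_transform_23:
  assumes "a * d - b * c = 1"
  shows "triple_prod u (a *\<^sub>R v + b *\<^sub>R w) (c *\<^sub>R v + d *\<^sub>R w) = triple_prod u v w"
proof (rule triple_prod_eqI)
  fix x :: "real^4"
  have "det (vector [x, u, a *\<^sub>R v + b *\<^sub>R w, c *\<^sub>R v + d *\<^sub>R w] :: real^4^4) =
      (a * d - b * c) * det (vector [x, u, v, w] :: real^4^4)"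
    unfolding det_4 vector_4 by (simp, algebra)
  then show "det (vector [x, u, a *\<^sub>R v + b *\<^sub>R w, c *\<^sub>R v + d *\<^sub>R w] :: real^4^4) =
      det (vector [x, u, v, w] :: real^4^4)"
    by (simp add: assms)
qed

section \<open>Rotations of timelike framed curves\<close>

lemma timelike_framed_curve_times_differentiable_on:
  assumes "timelike_framed_curve I \<gamma> v1 v2"
  shows "times_differentiable_on I k \<gamma>" "times_differentiable_on I k v1"
    "times_differentiable_on I k v2"
proof -
  have *: "times_differentiable_on I k (\<lambda>t. (\<gamma> t, v1 t, v2 t))"
    using assms smooth_on_imp_times_differentiable_on unfolding timelike_framed_curve_def by blast
  show "times_differentiable_on I k \<gamma>"
    using bounded_linear.times_differentiable_on[OF bounded_linear_fst *] by simp
  show "times_differentiable_on I k v1"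
    using bounded_linear.times_differentiable_on[OF bounded_linear_fst_comp[OF bounded_linear_snd] *]
    by simp
  show "times_differentiable_on I k v2"
    using bounded_linear.times_differentiable_on[OF bounded_linear_snd_comp[OF bounded_linear_snd] *]
    by simp
qed

lemma times_differentiable_on_has_vector_derivative:
  assumes "times_differentiable_on I (Suc 0) f" "t \<in> I"
  shows "(f has_vector_derivative vector_derivative f (at t within I)) (at t within I)"
  using assms by (auto simp flip: vector_derivative_works intro: differentiableI_vector)

text \<open>Both orders of each orthogonality are listed so that all of them can rewrite from left
  to right.\<close>

lemma timelike_framed_curve_inner:
  assumes "timelike_framed_curve I \<gamma> v1 v2" "t \<in> I"
  shows "pseudo_inner (\<gamma> t) (\<gamma> t) = -1"
    and "pseudo_inner (v1 t) (v1 t) = 1" "pseudo_inner (v2 t) (v2 t) = 1"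
    and "pseudo_inner (v1 t) (v2 t) = 0" "pseudo_inner (v2 t) (v1 t) = 0"
    and "pseudo_inner (\<gamma> t) (v1 t) = 0" "pseudo_inner (v1 t) (\<gamma> t) = 0"
    and "pseudo_inner (\<gamma> t) (v2 t) = 0" "pseudo_inner (v2 t) (\<gamma> t) = 0"
  using assms pseudo_inner_commute
  unfolding timelike_framed_curve_def AdS3_def S32_def Delta5_def by auto

text \<open>These are the structure equations for \<open>\<gamma>'\<close>, \<open>v1'\<close>,
  \<open>v2'\<close>, read off by pairing with the frame \<open>\<gamma>\<close>, \<open>v1\<close>,
  \<open>v2\<close>, \<open>\<mu>\<close>. In this form no vector has to be expanded in the
  frame.\<close>

lemma timelike_framed_curve_deriv_inner:
  assumes I: "\<And>t. t \<in> I \<Longrightarrow> at t within I \<noteq> bot"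
    and curve: "timelike_framed_curve I \<gamma> v1 v2" and t: "t \<in> I"
    and curv: "framed_curvature I \<gamma> v1 v2 t = (a, l, m, n)"
  defines "\<gamma>' \<equiv> vector_derivative \<gamma> (at t within I)"
    and "v1' \<equiv> vector_derivative v1 (at t within I)"
    and "v2' \<equiv> vector_derivative v2 (at t within I)"
    and "\<mu> \<equiv> triple_prod (\<gamma> t) (v1 t) (v2 t)"
  shows "pseudo_inner \<gamma>' (\<gamma> t) = 0" "pseudo_inner \<gamma>' (v1 t) = 0" "pseudo_inner \<gamma>' (v2 t) = 0"
    and "pseudo_inner v1' (\<gamma> t) = 0" "pseudo_inner v1' (v1 t) = 0" "pseudo_inner v1' (v2 t) = l"
    and "pseudo_inner v2' (\<gamma> t) = 0" "pseudo_inner v2' (v1 t) = - l" "pseudo_inner v2' (v2 t) = 0"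
    and "pseudo_inner \<gamma>' \<mu> = - a" "pseudo_inner v1' \<mu> = - m" "pseudo_inner v2' \<mu> = - n"
proof -
  note d = timelike_framed_curve_times_differentiable_on[OF curve,
      THEN times_differentiable_on_has_vector_derivative, OF t]
  \<comment> \<open>The three constant squares give the zero diagonal entries. The other three
    relations turn the known products of \<open>v1'\<close> with \<open>v2\<close> and of
    \<open>\<gamma>'\<close> with the normals into the missing ones.\<close>
  note dual = pseudo_inner_constant_imp[OF I t timelike_framed_curve_inner(1)[OF curve] d(1) d(1)]
    pseudo_inner_constant_imp[OF I t timelike_framed_curve_inner(2)[OF curve] d(2) d(2)]
    pseudo_inner_constant_imp[OF I t timelike_framed_curve_inner(3)[OF curve] d(3) d(3)]
    pseudo_inner_constant_imp[OF I t timelike_framed_curve_inner(5)[OF curve] d(3) d(2)]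
    pseudo_inner_constant_imp[OF I t timelike_framed_curve_inner(7)[OF curve] d(2) d(1)]
    pseudo_inner_constant_imp[OF I t timelike_framed_curve_inner(9)[OF curve] d(3) d(1)]
  show g: "pseudo_inner \<gamma>' (v1 t) = 0" "pseudo_inner \<gamma>' (v2 t) = 0"
    using curve t unfolding timelike_framed_curve_def \<gamma>'_def by auto
  show c: "pseudo_inner v1' (v2 t) = l" "pseudo_inner \<gamma>' \<mu> = - a"
    "pseudo_inner v1' \<mu> = - m" "pseudo_inner v2' \<mu> = - n"
    using curv unfolding framed_curvature_def Let_def \<gamma>'_def v1'_def v2'_def \<mu>_def by auto
  show "pseudo_inner \<gamma>' (\<gamma> t) = 0" "pseudo_inner v1' (\<gamma> t) = 0" "pseudo_inner v1' (v1 t) = 0"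
    "pseudo_inner v2' (\<gamma> t) = 0" "pseudo_inner v2' (v1 t) = - l" "pseudo_inner v2' (v2 t) = 0"
    using g c dual unfolding \<gamma>'_def v1'_def v2'_def by simp_all
qed

text \<open>Smoothness of the triple is reduced to each component at each finite order, where the
  closure properties apply.\<close>

lemma timelike_framed_curveI:
  assumes "\<And>t. t \<in> I \<Longrightarrow> at t within I \<noteq> bot"
    and "\<And>k. times_differentiable_on I k \<gamma>" "\<And>k. times_differentiable_on I k v1"
      "\<And>k. times_differentiable_on I k v2"
    and "\<And>t. t \<in> I \<Longrightarrow> pseudo_inner (\<gamma> t) (\<gamma> t) = -1"
    and "\<And>t. t \<in> I \<Longrightarrow> pseudo_inner (v1 t) (v1 t) = 1"
    and "\<And>t. t \<in> I \<Longrightarrow> pseudo_inner (v2 t) (v2 t) = 1"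
    and "\<And>t. t \<in> I \<Longrightarrow> pseudo_inner (v1 t) (v2 t) = 0"
    and "\<And>t. t \<in> I \<Longrightarrow> pseudo_inner (\<gamma> t) (v1 t) = 0"
    and "\<And>t. t \<in> I \<Longrightarrow> pseudo_inner (\<gamma> t) (v2 t) = 0"
    and "\<And>t. t \<in> I \<Longrightarrow> pseudo_inner (vector_derivative \<gamma> (at t within I)) (v1 t) = 0"
    and "\<And>t. t \<in> I \<Longrightarrow> pseudo_inner (vector_derivative \<gamma> (at t within I)) (v2 t) = 0"
  shows "timelike_framed_curve I \<gamma> v1 v2"
proof -
  have "smooth_on I (\<lambda>t. (\<gamma> t, v1 t, v2 t))"
    using assms(1) by (auto simp: smooth_on_iff_times_differentiable_on
        intro!: times_differentiable_on_Pair assms(2-4))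
  then show ?thesis
    using assms(5-) by (auto simp: timelike_framed_curve_def AdS3_def S32_def Delta5_def)
qed

text \<open>Differentiating the coefficients adds \<open>\<theta>' *\<^sub>R w2\<close> to the
  rotated \<open>v1'\<close> and subtracts \<open>\<theta>' *\<^sub>R w1\<close> from the rotated
  \<open>v2'\<close>. The first term raises \<open>l\<close> by \<open>\<theta>'\<close>; both are
  orthogonal to \<open>\<mu>\<close>, so \<open>(m, n)\<close> is merely rotated. The angle is left
  arbitrary here.\<close>

lemma timelike_framed_curve_rotate_normals:
  fixes \<theta> :: "real \<Rightarrow> real"
  assumes I: "\<And>t. t \<in> I \<Longrightarrow> at t within I \<noteq> bot"
    and curve: "timelike_framed_curve I \<gamma> v1 v2"
    and curv: "\<And>t. t \<in> I \<Longrightarrow> framed_curvature I \<gamma> v1 v2 t = (\<alpha> t, l t, m t, n t)"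
    and \<theta>: "smooth_on I \<theta>"
  defines "w1 \<equiv> \<lambda>t. cos (\<theta> t) *\<^sub>R v1 t + sin (\<theta> t) *\<^sub>R v2 t"
    and "w2 \<equiv> \<lambda>t. - sin (\<theta> t) *\<^sub>R v1 t + cos (\<theta> t) *\<^sub>R v2 t"
  shows "timelike_framed_curve I \<gamma> w1 w2"
    and "\<And>t. t \<in> I \<Longrightarrow> framed_curvature I \<gamma> w1 w2 t =
      (\<alpha> t, l t + vector_derivative \<theta> (at t within I),
       cos (\<theta> t) * m t + sin (\<theta> t) * n t, - sin (\<theta> t) * m t + cos (\<theta> t) * n t)"
proof -
  note D = timelike_framed_curve_times_differentiable_on[OF curve]
  note d = D[THEN times_differentiable_on_has_vector_derivative]
  note \<theta>D = times_differentiable_on_cos_sin[OF smooth_on_imp_times_differentiable_on[OF \<theta>]]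
  have w1D: "times_differentiable_on I k w1" for k
    unfolding w1_def
    by (intro times_differentiable_on_add times_differentiable_on_scaleR D \<theta>D)
  have w2D: "times_differentiable_on I k w2" for k
    unfolding w2_def
    by (intro times_differentiable_on_add times_differentiable_on_scaleR D \<theta>D
        bounded_linear.times_differentiable_on[OF bounded_linear_minus[OF bounded_linear_ident]])
  show "timelike_framed_curve I \<gamma> w1 w2"
  proof (rule timelike_framed_curveI[OF I D(1) w1D w2D], assumption)
    fix t assume t: "t \<in> I"
    note simps = pseudo_inner_linear_simps timelike_framed_curve_inner[OF curve t]
      timelike_framed_curve_deriv_inner[OF I curve t curv[OF t]]
    have cs: "(cos (\<theta> t))\<^sup>2 + (sin (\<theta> t))\<^sup>2 = 1" by simp
    show "pseudo_inner (\<gamma> t) (\<gamma> t) = -1"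
      "pseudo_inner (\<gamma> t) (w1 t) = 0" "pseudo_inner (\<gamma> t) (w2 t) = 0"
      "pseudo_inner (vector_derivative \<gamma> (at t within I)) (w1 t) = 0"
      "pseudo_inner (vector_derivative \<gamma> (at t within I)) (w2 t) = 0"
      "pseudo_inner (w1 t) (w2 t) = 0"
      by (simp_all add: w1_def w2_def simps)
    show "pseudo_inner (w1 t) (w1 t) = 1" "pseudo_inner (w2 t) (w2 t) = 1"
      using cs by (simp_all add: w1_def w2_def simps power2_eq_square)
  qed
  fix t assume t: "t \<in> I"
  define \<theta>' where "\<theta>' = vector_derivative \<theta> (at t within I)"
  define v1' where "v1' = vector_derivative v1 (at t within I)"
  define v2' where "v2' = vector_derivative v2 (at t within I)"
  note simps = pseudo_inner_linear_simps timelike_framed_curve_inner[OF curve t]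
    timelike_framed_curve_deriv_inner[OF I curve t curv[OF t]]
    timelike_framed_curve_deriv_inner[OF I curve t curv[OF t], folded v1'_def v2'_def]
    pseudo_inner_triple_prod_self
  note d\<theta> = smooth_on_has_vector_derivative[OF \<theta> t, folded \<theta>'_def]
  \<comment> \<open>The product rule for a scalar times a vector takes the scalar factor with a real
    derivative, hence the folding.\<close>
  note dcs = has_vector_derivative_cos_sin[OF d\<theta>,
      folded has_real_derivative_iff_has_vector_derivative]
  have "(w1 has_vector_derivative
      cos (\<theta> t) *\<^sub>R v1' + sin (\<theta> t) *\<^sub>R v2' + \<theta>' *\<^sub>R w2 t) (at t within I)"
    unfolding w1_def w2_def v1'_def v2'_def
    by (rule derivative_eq_intros dcs d t refl)+ (simp add: algebra_simps)
  then have w1': "vector_derivative w1 (at t within I) =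
      cos (\<theta> t) *\<^sub>R v1' + sin (\<theta> t) *\<^sub>R v2' + \<theta>' *\<^sub>R w2 t"
    using I t by (simp add: vector_derivative_within)
  have "(w2 has_vector_derivative
      - sin (\<theta> t) *\<^sub>R v1' + cos (\<theta> t) *\<^sub>R v2' - \<theta>' *\<^sub>R w1 t) (at t within I)"
    unfolding w1_def w2_def v1'_def v2'_def
    by (rule derivative_eq_intros dcs d t refl)+ (simp add: algebra_simps)
  then have w2': "vector_derivative w2 (at t within I) =
      - sin (\<theta> t) *\<^sub>R v1' + cos (\<theta> t) *\<^sub>R v2' - \<theta>' *\<^sub>R w1 t"
    using I t by (simp add: vector_derivative_within)
  have \<mu>: "triple_prod (\<gamma> t) (w1 t) (w2 t) = triple_prod (\<gamma> t) (v1 t) (v2 t)"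
    unfolding w1_def w2_def
    by (rule triple_prod_transform_23) (simp flip: power2_eq_square)
  have cs: "(cos (\<theta> t))\<^sup>2 + (sin (\<theta> t))\<^sup>2 = 1" by simp
  have l: "pseudo_inner (vector_derivative w1 (at t within I)) (w2 t) = l t + \<theta>'"
    unfolding w1' by (simp add: w1_def w2_def simps, use cs in algebra)
  show "framed_curvature I \<gamma> w1 w2 t =
      (\<alpha> t, l t + vector_derivative \<theta> (at t within I),
       cos (\<theta> t) * m t + sin (\<theta> t) * n t, - sin (\<theta> t) * m t + cos (\<theta> t) * n t)"
    unfolding framed_curvature_def Let_def \<mu> l \<theta>'_def[symmetric]
    unfolding w1' w2' by (simp add: w1_def w2_def simps)
qed

text \<open>The product of \<open>\<eta>'\<close> with \<open>v2\<close> is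
  \<open>sinh \<phi>\<close> times the second curvature entry. Its vanishing is therefore what keeps
  \<open>v2\<close> normal to the new curve, and why the normals are rotated first.\<close>

lemma timelike_framed_curve_boost:
  fixes \<phi> :: real
  assumes I: "\<And>t. t \<in> I \<Longrightarrow> at t within I \<noteq> bot"
    and curve: "timelike_framed_curve I \<gamma> v1 v2"
    and curv: "\<And>t. t \<in> I \<Longrightarrow> framed_curvature I \<gamma> v1 v2 t = (\<alpha> t, 0, m t, n t)"
  defines "\<eta> \<equiv> \<lambda>t. cosh \<phi> *\<^sub>R \<gamma> t + sinh \<phi> *\<^sub>R v1 t"
    and "w1 \<equiv> \<lambda>t. sinh \<phi> *\<^sub>R \<gamma> t + cosh \<phi> *\<^sub>R v1 t"
  shows "timelike_framed_curve I \<eta> w1 v2"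
    and "\<And>t. t \<in> I \<Longrightarrow> framed_curvature I \<eta> w1 v2 t =
      (cosh \<phi> * \<alpha> t + sinh \<phi> * m t, 0, sinh \<phi> * \<alpha> t + cosh \<phi> * m t, n t)"
proof -
  note D = timelike_framed_curve_times_differentiable_on[OF curve]
  note d = D[THEN times_differentiable_on_has_vector_derivative]
  have \<eta>D: "times_differentiable_on I k \<eta>" and w1D: "times_differentiable_on I k w1" for k
    unfolding \<eta>_def w1_def
    by (intro times_differentiable_on_add D
        bounded_linear.times_differentiable_on[OF bounded_linear_scaleR_right])+
  \<comment> \<open>Since \<open>\<phi>\<close> is constant, the derivatives mix with the same
    coefficients as the vectors, and so do \<open>\<alpha>\<close> and \<open>m\<close>.\<close>
  have \<eta>': "vector_derivative \<eta> (at t within I) =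
      cosh \<phi> *\<^sub>R vector_derivative \<gamma> (at t within I) + sinh \<phi> *\<^sub>R vector_derivative v1 (at t within I)"
    and w1': "vector_derivative w1 (at t within I) =
      sinh \<phi> *\<^sub>R vector_derivative \<gamma> (at t within I) + cosh \<phi> *\<^sub>R vector_derivative v1 (at t within I)"
    if t: "t \<in> I" for t
    unfolding \<eta>_def w1_def using I[OF t]
    by (auto intro!: vector_derivative_within has_vector_derivative_add d t
        bounded_linear.has_vector_derivative[OF bounded_linear_scaleR_right])
  \<comment> \<open>Used twice: it normalises the squares of \<open>\<eta>\<close> and
    \<open>w1\<close> to -1 and 1, and it is the unit determinant that preserves
    \<open>\<mu>\<close>.\<close>
  have ch: "cosh \<phi> * cosh \<phi> - sinh \<phi> * sinh \<phi> = 1"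
    using cosh_square_eq[of \<phi>] by (simp add: power2_eq_square)
  show "timelike_framed_curve I \<eta> w1 v2"
  proof (rule timelike_framed_curveI[OF I \<eta>D w1D D(3)], assumption)
    fix t assume t: "t \<in> I"
    note simps = \<eta>_def w1_def pseudo_inner_linear_simps
      timelike_framed_curve_inner[OF curve t]
      timelike_framed_curve_deriv_inner[OF I curve t curv[OF t]]
    show "pseudo_inner (\<eta> t) (\<eta> t) = -1" "pseudo_inner (w1 t) (w1 t) = 1"
      using ch by (simp_all add: simps)
    show "pseudo_inner (v2 t) (v2 t) = 1" "pseudo_inner (w1 t) (v2 t) = 0"
      "pseudo_inner (\<eta> t) (w1 t) = 0" "pseudo_inner (\<eta> t) (v2 t) = 0"
      "pseudo_inner (vector_derivative \<eta> (at t within I)) (w1 t) = 0"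
      "pseudo_inner (vector_derivative \<eta> (at t within I)) (v2 t) = 0"
      unfolding \<eta>'[OF t] by (simp_all add: simps)
  qed
  fix t assume t: "t \<in> I"
  have \<mu>: "triple_prod (\<eta> t) (w1 t) (v2 t) = triple_prod (\<gamma> t) (v1 t) (v2 t)"
    unfolding \<eta>_def w1_def using ch by (rule triple_prod_transform_12)
  show "framed_curvature I \<eta> w1 v2 t =
      (cosh \<phi> * \<alpha> t + sinh \<phi> * m t, 0, sinh \<phi> * \<alpha> t + cosh \<phi> * m t, n t)"
    unfolding framed_curvature_def Let_def \<mu> \<eta>'[OF t] w1'[OF t]
    by (simp add: pseudo_inner_linear_simps
        timelike_framed_curve_deriv_inner[OF I curve t curv[OF t]])
qed

theorem proposition3p9:
  fixes I :: "real set"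
    and \<gamma> v1 v2 :: "real \<Rightarrow> real^4"
    and \<alpha> l m n \<theta> :: "real \<Rightarrow> real"
    and \<phi> :: real
  assumes "is_interval I" and "interior I \<noteq> {}"
    and "timelike_framed_curve I \<gamma> v1 v2"
    and "\<forall>t\<in>I. framed_curvature I \<gamma> v1 v2 t = (\<alpha> t, l t, m t, n t)"
    and "smooth_on I \<theta>"
    and "\<forall>t\<in>I. vector_derivative \<theta> (at t within I) = - l t"
  shows "timelike_framed_curve I
           (AdS_parallel \<phi> \<theta> \<gamma> v1 v2) (parallel_v1 \<phi> \<theta> \<gamma> v1 v2) (parallel_v2 \<theta> v1 v2) \<and>
         (\<forall>t\<in>I. framed_curvature I
           (AdS_parallel \<phi> \<theta> \<gamma> v1 v2) (parallel_v1 \<phi> \<theta> \<gamma> v1 v2) (parallel_v2 \<theta> v1 v2) t =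
             (cosh \<phi> * \<alpha> t + sinh \<phi> * (cos (\<theta> t) * m t + sin (\<theta> t) * n t),
              0,
              sinh \<phi> * \<alpha> t + cosh \<phi> * (cos (\<theta> t) * m t + sin (\<theta> t) * n t),
              - sin (\<theta> t) * m t + cos (\<theta> t) * n t))"
proof -
  define w1 where "w1 = (\<lambda>t. cos (\<theta> t) *\<^sub>R v1 t + sin (\<theta> t) *\<^sub>R v2 t)"
  define w2 where "w2 = (\<lambda>t. - sin (\<theta> t) *\<^sub>R v1 t + cos (\<theta> t) *\<^sub>R v2 t)"
  note I = interval_at_within_neq_bot[OF assms(1,2)]
  note rot = timelike_framed_curve_rotate_normals[OF I assms(3) assms(4)[rule_format] assms(5),
      folded w1_def w2_def]
  \<comment> \<open>The hypothesis on the derivative of \<open>\<theta>\<close> enters here: the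
    second entry is \<open>l t + (- l t)\<close>.\<close>
  have curv: "framed_curvature I \<gamma> w1 w2 t =
      (\<alpha> t, 0, cos (\<theta> t) * m t + sin (\<theta> t) * n t, - sin (\<theta> t) * m t + cos (\<theta> t) * n t)"
    if "t \<in> I" for t
    using rot(2) assms(6) that by simp
  \<comment> \<open>The parallel frame is literally the boost of \<open>\<gamma>\<close>,
    \<open>w1\<close>, \<open>w2\<close>, so the two rotation lemmas compose.\<close>
  have "AdS_parallel \<phi> \<theta> \<gamma> v1 v2 = (\<lambda>t. cosh \<phi> *\<^sub>R \<gamma> t + sinh \<phi> *\<^sub>R w1 t)"
    "parallel_v1 \<phi> \<theta> \<gamma> v1 v2 = (\<lambda>t. sinh \<phi> *\<^sub>R \<gamma> t + cosh \<phi> *\<^sub>R w1 t)"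
    "parallel_v2 \<theta> v1 v2 = w2"
    by (simp_all add: fun_eq_iff AdS_parallel_def parallel_v1_def parallel_v2_def w1_def w2_def)
  then show ?thesis
    using timelike_framed_curve_boost[OF I rot(1) curv] by simp
qed

end
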